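(* Let $A$ be an $n\times n$ consensus matrix, let $K\subseteq V=\{1,\dots,n\}$ be the set of misbehaving agents, and consider $x(t+1)=Ax(t)+B_Ku_K(t)$. Assume that, for some $j\in V$, the zero dynamics of $(A,B_K,C_j)$ are exponentially stable. Let $A_{N_j}$ denote the matrix formed by the columns of $A$ with indices in $N_j$ (in the same order as in $C_j$), and consider the filter $$z(t+1)=(A+GC_j)z(t)-GC_jx(t),\qquad \tilde x(t)=Lz(t)+HC_jx(t),$$ with $G=-A_{N_j}$, $H=C_j^{\mathsf T}$, $L=I-HC_j$. Then, in the limit $t\to\infty$, the vector $\tilde x(t+1)-A\tilde x(t)$ is nonzero only if the input $u_K(t)$ is nonzero; that is, if $u_K(t)=0$ for all $t$, then $\tilde x(t+1)-A\tilde x(t)\to 0$ for all initial conditions $x(0),z(0)$. Moreover, if $K\subset N_j$, then the filter asymptotically estimates the state of the network independently of the behavior of the agents $K$: $\tilde x(t)-x(t)\to 0$ as $t\to\infty$ for all inputs $u_K$ and all initial conditions $x(0),z(0)$.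
   Context: A consensus matrix is a real square matrix that is row stochastic (nonnegative entries, rows summing to one) and primitive. Its communication graph is the directed graph on $V$ with edge $(j,i)$ if and only if $A_{ij}\neq 0$; the neighbor set of $j$ is $N_j=\{i\in V:(i,j)\in E\}$. For $K=\{i_1,i_2,\dots\}\subseteq V$, $B_K=[e_{i_1}\ e_{i_2}\ \cdots]$; for $j\in V$ with $N_j=\{n_1,\dots,n_p\}$, $C_j=[e_{n_1}\ \cdots\ e_{n_p}]^{\mathsf T}$, with $e_i$ the canonical basis vectors. The zero dynamics of $(A,B_K,C_j)$ are the nontrivial state trajectories $x(\cdot)$ of $x(t+1)=Ax(t)+B_Ku_K(t)$ (over all initial states and inputs) with $C_jx(t)=0$ for all $t\in\mathbb{N}$; they are exponentially stable if all such trajectories converge exponentially to zero. *)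

theory Defs
  imports Complex_Main "Jordan_Normal_Form.Matrix"
begin

(* Agents are numbered from 0, so V = {0..<n}. *)

definition row_stochastic :: "real mat \<Rightarrow> bool" where
  "row_stochastic A \<longleftrightarrow>
     (\<forall>i<dim_row A. \<forall>j<dim_col A. 0 \<le> A $$ (i, j)) \<and>
     (\<forall>i<dim_row A. (\<Sum>j<dim_col A. A $$ (i, j)) = 1)"

definition primitive_matrix :: "real mat \<Rightarrow> bool" where
  "primitive_matrix A \<longleftrightarrow>
     square_mat A \<and>
     (\<forall>i<dim_row A. \<forall>j<dim_col A. 0 \<le> A $$ (i, j)) \<and>
     (\<exists>k\<ge>1. \<forall>i<dim_row A. \<forall>j<dim_col A. 0 < (A ^\<^sub>m k) $$ (i, j))"

definition consensus_matrix :: "nat \<Rightarrow> real mat \<Rightarrow> bool" where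
  "consensus_matrix n A \<longleftrightarrow>
     A \<in> carrier_mat n n \<and> row_stochastic A \<and> primitive_matrix A"

definition comm_edges :: "real mat \<Rightarrow> (nat \<times> nat) set" where
  "comm_edges A = {(j, i). i < dim_row A \<and> j < dim_col A \<and> A $$ (i, j) \<noteq> 0}"

definition neighbors :: "real mat \<Rightarrow> nat \<Rightarrow> nat set" where
  "neighbors A j = {i. (i, j) \<in> comm_edges A}"

(* Index sets enter the matrices below through an enumeration without repetitions. *)

definition input_matrix :: "nat \<Rightarrow> nat list \<Rightarrow> real mat" where
  "input_matrix n ks = mat_of_cols n (map (unit_vec n) ks)"

definition output_matrix :: "nat \<Rightarrow> nat list \<Rightarrow> real mat" where
  "output_matrix n ns = mat_of_rows n (map (unit_vec n) ns)"

definition column_submatrix :: "real mat \<Rightarrow> nat list \<Rightarrow> real mat" where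
  "column_submatrix A ns = mat_of_cols (dim_row A) (map (col A) ns)"

definition state_trajectory ::
    "real mat \<Rightarrow> real mat \<Rightarrow> (nat \<Rightarrow> real vec) \<Rightarrow> (nat \<Rightarrow> real vec) \<Rightarrow> bool" where
  "state_trajectory A B u x \<longleftrightarrow>
     (\<forall>t. u t \<in> carrier_vec (dim_col B)) \<and>
     (\<forall>t. x t \<in> carrier_vec (dim_row A)) \<and>
     (\<forall>t. x (Suc t) = A *\<^sub>v x t + B *\<^sub>v u t)"

definition zero_dynamics ::
    "real mat \<Rightarrow> real mat \<Rightarrow> real mat \<Rightarrow> (nat \<Rightarrow> real vec) set" where
  "zero_dynamics A B C =
     {x. (\<exists>t. x t \<noteq> 0\<^sub>v (dim_row A)) \<and>
         (\<exists>u. state_trajectory A B u x) \<and>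
         (\<forall>t. C *\<^sub>v x t = 0\<^sub>v (dim_row C))}"

definition euclid_norm :: "real vec \<Rightarrow> real" where
  "euclid_norm v = sqrt (v \<bullet> v)"

definition converges_to_zero :: "(nat \<Rightarrow> real vec) \<Rightarrow> bool" where
  "converges_to_zero x \<longleftrightarrow> (\<lambda>t. euclid_norm (x t)) \<longlonglongrightarrow> 0"

definition converges_exponentially_to_zero :: "(nat \<Rightarrow> real vec) \<Rightarrow> bool" where
  "converges_exponentially_to_zero x \<longleftrightarrow>
     (\<exists>M \<rho>. 0 < \<rho> \<and> \<rho> < 1 \<and> (\<forall>t. euclid_norm (x t) \<le> M * \<rho> ^ t))"

definition exp_stable_zero_dynamics :: "real mat \<Rightarrow> real mat \<Rightarrow> real mat \<Rightarrow> bool" where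
  "exp_stable_zero_dynamics A B C \<longleftrightarrow>
     (\<forall>x \<in> zero_dynamics A B C. converges_exponentially_to_zero x)"

definition filter_trajectory ::
    "real mat \<Rightarrow> real mat \<Rightarrow> real mat \<Rightarrow> real mat \<Rightarrow> real mat \<Rightarrow>
     (nat \<Rightarrow> real vec) \<Rightarrow> (nat \<Rightarrow> real vec) \<Rightarrow> (nat \<Rightarrow> real vec) \<Rightarrow> bool" where
  "filter_trajectory A C G H L x z xe \<longleftrightarrow>
     (\<forall>t. z t \<in> carrier_vec (dim_row A)) \<and>
     (\<forall>t. z (Suc t) = (A + G * C) *\<^sub>v z t - (G * C) *\<^sub>v x t) \<and>
     (\<forall>t. xe t = L *\<^sub>v z t + (H * C) *\<^sub>v x t)"

end

(* The estimation error e = z - x obeys e(t+1) = A L e(t) - B u(t), and xe - x = L e, where L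
   is the coordinate projection that kills the entries in N_j. Some power A^k is positive with
   rows summing to one, so the row sums of (A L)^k, being at most those of A^k L, are bounded
   away from 1, because N_j is nonempty: A L is Schur stable. Without input this gives e -> 0.
   If K is contained in N_j then L B = 0, so A L e follows the autonomous recursion of A L
   whatever the input is. *)

theory Submission
  imports Defs
begin

section \<open>Powers of row-stochastic matrices and decay of the masked recursion\<close>

lemma row_stochastic_pow:
  assumes A: "A \<in> carrier_mat n n" and st: "row_stochastic A"
  shows "row_stochastic (A ^\<^sub>m k)"
proof (induction k)
  case 0
  then show ?case using A by (auto simp: row_stochastic_def)
next
  case (Suc k)
  have Ak: "A ^\<^sub>m k \<in> carrier_mat n n" using A by simp
  have entry: "(A ^\<^sub>m Suc k) $$ (i, j) = (\<Sum>l<n. (A ^\<^sub>m k) $$ (i, l) * A $$ (l, j))"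
    if "i < n" "j < n" for i j
    using A Ak that by (simp add: scalar_prod_def atLeast0LessThan)
  have rows: "(\<Sum>j<n. (A ^\<^sub>m Suc k) $$ (i, j)) = 1" if i: "i < n" for i
  proof -
    have "(\<Sum>j<n. (A ^\<^sub>m Suc k) $$ (i, j)) = (\<Sum>j<n. \<Sum>l<n. (A ^\<^sub>m k) $$ (i, l) * A $$ (l, j))"
      using i by (intro sum.cong refl entry) auto
    also have "\<dots> = (\<Sum>l<n. (A ^\<^sub>m k) $$ (i, l) * (\<Sum>j<n. A $$ (l, j)))"
      by (subst sum.swap) (simp add: sum_distrib_left)
    also have "\<dots> = (\<Sum>l<n. (A ^\<^sub>m k) $$ (i, l))"
      using st A by (intro sum.cong) (auto simp: row_stochastic_def)
    also have "\<dots> = 1"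
      using Suc i carrier_matD[OF Ak] by (simp only: row_stochastic_def)
    finally show ?thesis .
  qed
  have "0 \<le> (A ^\<^sub>m Suc k) $$ (i, j)" if "i < n" "j < n" for i j
    unfolding entry[OF that] using Suc st that A Ak
    by (intro sum_nonneg mult_nonneg_nonneg) (auto simp: row_stochastic_def)
  moreover have "A ^\<^sub>m Suc k \<in> carrier_mat n n" using A by (rule pow_carrier_mat)
  ultimately show ?case
    unfolding row_stochastic_def using rows by (metis carrier_matD)
qed

text \<open>\<open>pow_mat\<close> appends its new factor on the right, whereas unrolling a
  recursion puts the newest step on the left.\<close>

lemma pow_mat_Suc_left:
  assumes A: "A \<in> carrier_mat n n"
  shows "A ^\<^sub>m Suc k = A * A ^\<^sub>m k"
proof (induction k)
  case 0
  then show ?case using A by simp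
next
  case (Suc k)
  have "A ^\<^sub>m Suc (Suc k) = A * A ^\<^sub>m k * A" using Suc by simp
  also have "\<dots> = A * A ^\<^sub>m Suc k" using assoc_mult_mat[OF A pow_carrier_mat[OF A] A] by simp
  finally show ?case .
qed

text \<open>Absolute values are unrolled back to time \<open>t\<close>. Only the mask of the oldest
  step is kept, and the later steps are enlarged to full sums, so that powers of \<open>A\<close>
  appear instead of powers of the masked matrix. At least one step is taken, hence
  \<open>Suc s\<close>: with no step there would be no mask.\<close>

lemma masked_recursion_bound:
  fixes e :: "nat \<Rightarrow> nat \<Rightarrow> real"
  assumes A: "A \<in> carrier_mat n n" and st: "row_stochastic A"
    and rec: "\<And>t i. i < n \<Longrightarrow> e (Suc t) i = (\<Sum>l\<in>{..<n} - S. A $$ (i, l) * e t l)"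
    and c: "\<And>i. i < n \<Longrightarrow> \<bar>e t i\<bar> \<le> c"
    and i: "i < n"
  shows "\<bar>e (t + Suc s) i\<bar> \<le> (\<Sum>l\<in>{..<n} - S. (A ^\<^sub>m Suc s) $$ (i, l)) * c"
proof -
  have nn: "0 \<le> A $$ (i, l)" if "i < n" "l < n" for i l
    using st A that by (auto simp: row_stochastic_def)
  show ?thesis
    using i
  proof (induction s arbitrary: i)
    case 0
    have "\<bar>e (Suc t) i\<bar> \<le> (\<Sum>l\<in>{..<n} - S. \<bar>A $$ (i, l) * e t l\<bar>)"
      unfolding rec[OF 0] by (rule sum_abs)
    also have "\<dots> \<le> (\<Sum>l\<in>{..<n} - S. A $$ (i, l) * c)"
      using c nn 0 by (intro sum_mono) (auto simp: abs_mult intro!: mult_left_mono)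
    finally show ?case using A by (simp add: sum_distrib_right)
  next
    case (Suc s)
    define R where "R l = (\<Sum>m\<in>{..<n} - S. (A ^\<^sub>m Suc s) $$ (l, m))" for l
    have bnd: "\<bar>e (t + Suc s) l\<bar> \<le> R l * c" if "l < n" for l
      using Suc.IH[OF that] by (simp only: R_def)
    have powS: "A ^\<^sub>m Suc (Suc s) = A * A ^\<^sub>m Suc s"
      using A by (rule pow_mat_Suc_left)
    have As: "A ^\<^sub>m Suc s \<in> carrier_mat n n" using A by (rule pow_carrier_mat)
    have "\<bar>e (t + Suc (Suc s)) i\<bar> \<le> (\<Sum>l\<in>{..<n} - S. \<bar>A $$ (i, l) * e (t + Suc s) l\<bar>)"
      using rec[OF Suc.prems, of "t + Suc s"] by (simp add: sum_abs)
    \<comment> \<open>The mask of the newest step is given up here; the one inside \<open>R\<close>,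
      which belongs to the step from \<open>t\<close> to \<open>Suc t\<close>, survives.\<close>
    also have "\<dots> \<le> (\<Sum>l<n. \<bar>A $$ (i, l) * e (t + Suc s) l\<bar>)"
      by (rule sum_mono2) auto
    also have "\<dots> \<le> (\<Sum>l<n. A $$ (i, l) * (R l * c))"
      using bnd nn Suc.prems
      by (intro sum_mono) (auto simp: abs_mult simp del: pow_mat.simps intro!: mult_left_mono)
    also have "\<dots> = (\<Sum>l<n. A $$ (i, l) * R l) * c"
      by (simp add: sum_distrib_right mult.assoc)
    also have "(\<Sum>l<n. A $$ (i, l) * R l)
        = (\<Sum>m\<in>{..<n} - S. \<Sum>l<n. A $$ (i, l) * (A ^\<^sub>m Suc s) $$ (l, m))"
      unfolding R_def sum_distrib_left by (rule sum.swap)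
    also have "\<dots> = (\<Sum>m\<in>{..<n} - S. (A ^\<^sub>m Suc (Suc s)) $$ (i, m))"
      unfolding powS using A As Suc.prems
      by (intro sum.cong refl)
         (auto simp: scalar_prod_def atLeast0LessThan simp del: pow_mat.simps)
    finally show ?case .
  qed
qed

text \<open>Masking column \<open>r\<close> removes a positive entry from every row, so each masked
  sum falls strictly below one. There are finitely many rows, and the largest masked sum serves as
  the uniform bound.\<close>

lemma masked_row_sum_less_one:
  assumes st: "row_stochastic P" and P: "P \<in> carrier_mat n n"
    and pos: "\<And>i j. i < n \<Longrightarrow> j < n \<Longrightarrow> 0 < P $$ (i, j)"
    and r: "r \<in> S" "r < n"
  obtains \<rho> where "0 \<le> \<rho>" "\<rho> < 1" "\<And>i. i < n \<Longrightarrow> (\<Sum>l\<in>{..<n} - S. P $$ (i, l)) \<le> \<rho>"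
proof -
  define f where "f i = (\<Sum>l\<in>{..<n} - S. P $$ (i, l))" for i
  have lt: "f i < 1" if i: "i < n" for i
  proof -
    have "f i < (\<Sum>l<n. P $$ (i, l))"
      unfolding f_def using pos i r
      by (intro sum_strict_mono2[of _ _ r]) (auto intro: less_imp_le)
    then show ?thesis using st P i by (auto simp: row_stochastic_def)
  qed
  have nonneg: "0 \<le> f i" if "i < n" for i
    unfolding f_def using pos that by (intro sum_nonneg) (auto intro: less_imp_le)
  have fin: "finite (f ` {..<n})" and ne: "f ` {..<n} \<noteq> {}" using r by auto
  show thesis
  proof
    show "0 \<le> Max (f ` {..<n})" using nonneg[OF r(2)] Max_ge[OF fin imageI, of r] r(2)
      by (meson lessThan_iff order_trans)
    show "Max (f ` {..<n}) < 1" using Max_in[OF fin ne] lt by auto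
    show "(\<Sum>l\<in>{..<n} - S. P $$ (i, l)) \<le> Max (f ` {..<n})" if "i < n" for i
      unfolding f_def[symmetric] using that by (intro Max_ge fin) auto
  qed
qed

text \<open>Primitivity yields a positive power \<open>k\<close> of \<open>A\<close>, whose masked
  row sums are at most some \<rho> < 1. The bound on all coordinates therefore shrinks by the factor
  \<rho> over every \<open>k\<close> steps, and it does not grow in between.\<close>

lemma masked_recursion_tendsto_0:
  fixes e :: "nat \<Rightarrow> nat \<Rightarrow> real"
  assumes cons: "consensus_matrix n A"
    and r: "r \<in> S" "r < n"
    and rec: "\<And>t i. i < n \<Longrightarrow> e (Suc t) i = (\<Sum>l\<in>{..<n} - S. A $$ (i, l) * e t l)"
    and i: "i < n"
  shows "(\<lambda>t. e t i) \<longlonglongrightarrow> 0"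
proof -
  have A: "A \<in> carrier_mat n n" and st: "row_stochastic A"
    using cons by (auto simp: consensus_matrix_def)
  obtain k where "k \<ge> 1" and pos: "\<And>i j. i < n \<Longrightarrow> j < n \<Longrightarrow> 0 < (A ^\<^sub>m k) $$ (i, j)"
    using cons A unfolding consensus_matrix_def primitive_matrix_def by auto
  then obtain s where k: "k = Suc s" by (cases k) auto
  obtain \<rho> where \<rho>: "0 \<le> \<rho>" "\<rho> < 1"
    and row\<rho>: "\<And>i. i < n \<Longrightarrow> (\<Sum>l\<in>{..<n} - S. (A ^\<^sub>m k) $$ (i, l)) \<le> \<rho>"
    using masked_row_sum_less_one[OF row_stochastic_pow[OF A st] pow_carrier_mat[OF A] pos r]
    by blast
  \<comment> \<open>The sum serves as a convenient upper bound for the largest initial coordinate in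
    absolute value.\<close>
  define c where "c = (\<Sum>i<n. \<bar>e 0 i\<bar>)"
  have c0: "0 \<le> c" by (simp add: c_def sum_nonneg)
  have c: "\<bar>e 0 i\<bar> \<le> c" if "i < n" for i
    unfolding c_def using that by (intro member_le_sum) auto
  \<comment> \<open>The bound is claimed for all times from \<open>k * m\<close> on, not only at
    multiples of \<open>k\<close>, so that it gives convergence of the whole sequence.\<close>
  have decay: "\<bar>e t i\<bar> \<le> c * \<rho> ^ m" if "k * m \<le> t" "i < n" for t m i
    using that
  proof (induction m arbitrary: t i)
    case 0
    show ?case
    proof (cases t)
      case 0
      then show ?thesis using c \<open>i < n\<close> by simp
    next
      case (Suc t')
      have nonneg: "0 \<le> (A ^\<^sub>m t) $$ (i, l)" if "l < n" for l
        using row_stochastic_pow[OF A st, of t] \<open>i < n\<close> that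
        unfolding row_stochastic_def carrier_matD[OF pow_carrier_mat[OF A]] by auto
      have row_sum: "(\<Sum>l<n. (A ^\<^sub>m t) $$ (i, l)) = 1"
        using row_stochastic_pow[OF A st, of t] \<open>i < n\<close>
        unfolding row_stochastic_def carrier_matD[OF pow_carrier_mat[OF A]] by auto
      \<comment> \<open>For \<open>m = 0\<close> no contraction is required: the full rows of
        \<open>A ^\<^sub>m t\<close> sum to one, so the initial bound \<open>c\<close>
        persists.\<close>
      have "\<bar>e t i\<bar> \<le> (\<Sum>l\<in>{..<n} - S. (A ^\<^sub>m t) $$ (i, l)) * c"
        using masked_recursion_bound[OF A st rec c \<open>i < n\<close>, where s = t'] Suc
        by (simp del: pow_mat.simps)
      also have "\<dots> \<le> (\<Sum>l<n. (A ^\<^sub>m t) $$ (i, l)) * c"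
        using nonneg c0 by (intro mult_right_mono sum_mono2) auto
      also have "\<dots> = c"
        by (simp add: row_sum)
      finally show ?thesis by simp
    qed
  next
    case (Suc m)
    then have km: "k * m \<le> t - k" and t: "t - k + k = t" by auto
    \<comment> \<open>The induction hypothesis bounds all coordinates at time \<open>t - k\<close>;
      one block of \<open>k\<close> steps leads from there to \<open>t\<close>.\<close>
    have "\<bar>e t i\<bar> \<le> (\<Sum>l\<in>{..<n} - S. (A ^\<^sub>m k) $$ (i, l)) * (c * \<rho> ^ m)"
      using masked_recursion_bound[OF A st rec Suc.IH[OF km] \<open>i < n\<close>, where s = s]
      unfolding k[symmetric] t by simp
    also have "\<dots> \<le> \<rho> * (c * \<rho> ^ m)"
      using row\<rho>[OF \<open>i < n\<close>] c0 \<rho> by (intro mult_right_mono) auto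
    finally show ?case by (simp add: mult_ac)
  qed
  have lim: "(\<lambda>m. c * \<rho> ^ m) \<longlonglongrightarrow> 0"
    using \<rho> by (intro tendsto_mult_right_zero LIMSEQ_realpow_zero)
  show ?thesis
  proof (rule LIMSEQ_I)
    fix \<epsilon> :: real assume "0 < \<epsilon>"
    then obtain m where "c * \<rho> ^ m < \<epsilon>"
      using order_tendstoD(2)[OF lim] by (auto simp: eventually_sequentially)
    then show "\<exists>N. \<forall>t\<ge>N. norm (e t i - 0) < \<epsilon>"
      using decay[OF _ i] by (intro exI[of _ "k * m"]) (auto intro: le_less_trans)
  qed
qed

section \<open>Coordinatewise convergence of vector sequences\<close>

lemma converges_to_zeroI:
  assumes "\<And>t. v t \<in> carrier_vec n" and "\<And>i. i < n \<Longrightarrow> (\<lambda>t. v t $ i) \<longlonglongrightarrow> 0"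
  shows "converges_to_zero v"
proof -
  have eq: "euclid_norm (v t) = sqrt (\<Sum>i<n. v t $ i * v t $ i)" for t
    using assms(1)[of t] by (auto simp: euclid_norm_def scalar_prod_def atLeast0LessThan)
  have "(\<lambda>t. sqrt (\<Sum>i<n. v t $ i * v t $ i)) \<longlonglongrightarrow> sqrt (\<Sum>i<n. 0 * 0)"
    using assms(2) by (intro tendsto_intros) auto
  then show ?thesis by (simp add: converges_to_zero_def eq)
qed

lemma mult_mat_vec_tendsto_0:
  fixes M :: "real mat"
  assumes "M \<in> carrier_mat m n" and "\<And>t. v t \<in> carrier_vec n"
    and "\<And>i. i < n \<Longrightarrow> (\<lambda>t. v t $ i) \<longlonglongrightarrow> 0" and "i < m"
  shows "(\<lambda>t. (M *\<^sub>v v t) $ i) \<longlonglongrightarrow> 0"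
proof -
  have eq: "(M *\<^sub>v v t) $ i = (\<Sum>l<n. M $$ (i, l) * v t $ l)" for t
    using assms(1,4) assms(2)[of t] by (auto simp: scalar_prod_def atLeast0LessThan)
  show ?thesis
    unfolding eq using assms(3) by (intro tendsto_null_sum tendsto_mult_right_zero) auto
qed

section \<open>Selection matrices and the neighbor set\<close>

lemma output_matrix_carrier [simp]: "output_matrix n ns \<in> carrier_mat (length ns) n"
  unfolding output_matrix_def
  by (rule mat_of_rows_carrier(1)[where vs = "map (unit_vec n) ns", simplified])

text \<open>The rows of the output matrix are distinct unit vectors, so its Gram matrix is the
  coordinate projection onto the span of the selected ones. A repeated index would put its
  multiplicity on the diagonal instead of 1.\<close>

lemma output_matrix_gram:
  assumes "distinct ns" and "set ns \<subseteq> {..<n}"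
  shows "transpose_mat (output_matrix n ns) * output_matrix n ns
    = mat n n (\<lambda>(i, l). if i = l \<and> i \<in> set ns then 1 else 0)" (is "?P = ?D")
proof (rule eq_matI)
  fix i l assume "i < dim_row ?D" "l < dim_col ?D"
  then have i: "i < n" and l: "l < n" by auto
  have dims: "dim_row (output_matrix n ns) = length ns" "dim_col (output_matrix n ns) = n"
    by (simp_all add: output_matrix_def)
  have ix: "output_matrix n ns $$ (k, a) = (if a = ns ! k then 1 else 0)"
    if "k < length ns" "a < n" for k a
  proof -
    have "ns ! k < n" using assms(2) nth_mem[OF that(1)] by auto
    then show ?thesis using that by (simp add: output_matrix_def mat_of_rows_def)
  qed
  have "?P $$ (i, l)
      = (\<Sum>k<length ns. output_matrix n ns $$ (k, i) * output_matrix n ns $$ (k, l))"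
    using i l by (simp add: dims scalar_prod_def atLeast0LessThan)
  \<comment> \<open>The summand is put in the form of a function applied to \<open>ns ! k\<close>,
    so that the bijection between positions and entries turns the sum into one over
    \<open>set ns\<close>.\<close>
  also have "\<dots> = (\<Sum>k<length ns. (\<lambda>a. if a = i \<and> a = l then 1 else 0) (ns ! k))"
    using i l by (intro sum.cong) (auto simp: ix)
  also have "\<dots> = (\<Sum>a\<in>set ns. if a = i \<and> a = l then 1 else 0)"
    using bij_betw_nth[OF assms(1) refl refl] by (rule sum.reindex_bij_betw)
  also have "\<dots> = (\<Sum>a\<in>set ns. if a = i then if i = l then 1 else 0 else 0)"
    by (intro sum.cong) auto
  also have "\<dots> = ?D $$ (i, l)"
    using i l by (simp add: sum.delta)
  finally show "?P $$ (i, l) = ?D $$ (i, l)" .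
qed (auto simp: output_matrix_def)

text \<open>Multiplying by a unit vector picks out a column. This turns the filter gain
  \<open>G\<close> into \<open>- (A * H)\<close>.\<close>

lemma column_submatrix_eq_mult:
  assumes A: "A \<in> carrier_mat m n" and ns: "set ns \<subseteq> {..<n}"
  shows "column_submatrix A ns = A * transpose_mat (output_matrix n ns)"
proof (rule eq_matI)
  let ?C = "output_matrix n ns"
  fix i k assume "i < dim_row (A * transpose_mat ?C)" "k < dim_col (A * transpose_mat ?C)"
  then have i: "i < m" and k: "k < length ns" using A by (auto simp: output_matrix_def)
  have nk: "ns ! k < n" using ns nth_mem[OF k] by auto
  have "(A * transpose_mat ?C) $$ (i, k) = row A i \<bullet> row ?C k"
    using A i k by (simp add: output_matrix_def)
  also have "row ?C k = unit_vec n (ns ! k)"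
    using k by (simp add: output_matrix_def)
  also have "row A i \<bullet> unit_vec n (ns ! k) = A $$ (i, ns ! k)"
    using A i nk by simp
  also have "\<dots> = column_submatrix A ns $$ (i, k)"
    using A i k nk by (simp add: column_submatrix_def mat_of_cols_def)
  finally show "column_submatrix A ns $$ (i, k) = (A * transpose_mat ?C) $$ (i, k)" ..
qed (use A in \<open>auto simp: column_submatrix_def output_matrix_def\<close>)

text \<open>By the orientation of the edges, the neighbors of \<open>j\<close> are the support of
  row \<open>j\<close>, and a row that sums to one has a nonzero entry. The index found here is the
  masked column that makes the contraction strict.\<close>

lemma neighbors_nonempty:
  assumes "A \<in> carrier_mat n n" and "row_stochastic A" and "j < n"
  obtains r where "r \<in> neighbors A j" "r < n"
proof -
  have "(\<Sum>l<n. A $$ (j, l)) \<noteq> 0"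
    using assms by (auto simp: row_stochastic_def)
  then obtain r where "r < n" "A $$ (j, r) \<noteq> 0"
    by (auto elim: sum.not_neutral_contains_not_neutral)
  then show ?thesis
    using assms that by (auto simp: neighbors_def comm_edges_def)
qed

theorem mainTheorem8:
  fixes A B C G H L :: "real mat" and n j :: nat and K :: "nat set" and ks ns :: "nat list"
  assumes "consensus_matrix n A"
    and "K \<subseteq> {0..<n}" and "distinct ks" and "set ks = K"
    and "j \<in> {0..<n}" and "distinct ns" and "set ns = neighbors A j"
    and "B = input_matrix n ks" and "C = output_matrix n ns"
    and "exp_stable_zero_dynamics A B C"
    and "G = - column_submatrix A ns" and "H = transpose_mat C" and "L = 1\<^sub>m n - H * C"
  shows "(\<forall>u x z xe. state_trajectory A B u x \<longrightarrow> filter_trajectory A C G H L x z xe \<longrightarrow>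
            (\<forall>t. u t = 0\<^sub>v (card K)) \<longrightarrow>
            converges_to_zero (\<lambda>t. xe (Suc t) - A *\<^sub>v xe t)) \<and>
         (K \<subseteq> neighbors A j \<longrightarrow>
            (\<forall>u x z xe. state_trajectory A B u x \<longrightarrow> filter_trajectory A C G H L x z xe \<longrightarrow>
               converges_to_zero (\<lambda>t. xe t - x t)))"
proof -

  \<comment> \<open>The projection and the closed-loop matrix\<close>
  have A: "A \<in> carrier_mat n n" and st: "row_stochastic A"
    using assms(1) by (auto simp: consensus_matrix_def)
  have ns: "set ns \<subseteq> {..<n}"
    using A assms(7) by (auto simp: neighbors_def comm_edges_def)
  obtain r where r: "r \<in> set ns" "r < n"
    using neighbors_nonempty[OF A st, of j] assms(5,7) by auto
  have B: "B \<in> carrier_mat n (card K)"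
    using distinct_card[OF assms(3)] assms(4)
      mat_of_cols_carrier(1)[of n "map (unit_vec n) ks :: real vec list"]
    by (simp add: assms(8) input_matrix_def)
  have C: "C \<in> carrier_mat (length ns) n" and H: "H \<in> carrier_mat n (length ns)"
    by (simp_all add: assms(9,12))
  have HC: "H * C = mat n n (\<lambda>(i, l). if i = l \<and> i \<in> set ns then 1 else 0)"
    unfolding assms(9,12) using assms(6) ns by (rule output_matrix_gram)
  have HCc: "H * C \<in> carrier_mat n n" using H C by simp
  have L: "L \<in> carrier_mat n n" unfolding assms(13) using HCc by (simp add: minus_carrier_mat)
  have AL: "A * L \<in> carrier_mat n n" using A L by simp
  have Lv: "(L *\<^sub>v v) $ i = (if i \<in> set ns then 0 else v $ i)"
    if "v \<in> carrier_vec n" "i < n" for v i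
  proof -
    have Lil: "L $$ (i, l) = (if l = i then if i \<in> set ns then 0 else 1 else 0)" if "l < n" for l
      unfolding assms(13) HC using that \<open>i < n\<close> by auto
    have "(L *\<^sub>v v) $ i = (\<Sum>l<n. L $$ (i, l) * v $ l)"
      using that L by (auto simp: scalar_prod_def atLeast0LessThan)
    also have "\<dots> = (\<Sum>l<n. if l = i then if i \<in> set ns then 0 else v $ i else 0)"
      by (rule sum.cong) (auto simp: Lil)
    finally show ?thesis using that by (simp add: sum.delta)
  qed
  \<comment> \<open>This brings multiplication by \<open>A * L\<close> into the form of the masked
    recursion, the mask being \<open>set ns\<close>.\<close>
  have ALv: "((A * L) *\<^sub>v v) $ i = (\<Sum>l\<in>{..<n} - set ns. A $$ (i, l) * v $ l)"
    if v: "v \<in> carrier_vec n" and i: "i < n" for v i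
  proof -
    have "((A * L) *\<^sub>v v) $ i = (A *\<^sub>v (L *\<^sub>v v)) $ i"
      using A L v by (simp add: assoc_mult_mat_vec)
    also have "\<dots> = (\<Sum>l<n. A $$ (i, l) * (L *\<^sub>v v) $ l)"
      using A L i by (simp add: scalar_prod_def atLeast0LessThan)
    also have "\<dots> = (\<Sum>l\<in>{..<n} - set ns. A $$ (i, l) * v $ l)"
      using v by (intro sum.mono_neutral_cong_right) (auto simp: Lv)
    finally show ?thesis .
  qed
  \<comment> \<open>Stability of \<open>A * L\<close> is stated for arbitrary sequences because it
    is applied twice: to the error itself when the input vanishes, and to its image under
    \<open>A * L\<close> otherwise.\<close>
  have stable: "(\<lambda>t. v t $ i) \<longlonglongrightarrow> 0"
    if "\<And>t. v t \<in> carrier_vec n" "\<And>t. v (Suc t) = (A * L) *\<^sub>v v t" "i < n"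
    for v :: "nat \<Rightarrow> real vec" and i
    using that by (intro masked_recursion_tendsto_0[OF assms(1) r]) (auto simp: ALv)
  have G: "G = - (A * H)"
    unfolding assms(9,11,12) column_submatrix_eq_mult[OF A ns] ..
  have GC: "G * C \<in> carrier_mat n n"
    using A H C by (simp add: G)
  \<comment> \<open>The choice of gains makes \<open>A + G * C\<close> equal to
    \<open>A - A * (H * C)\<close>, and \<open>A\<close> factors out on the left.\<close>
  have closed_loop: "A + G * C = A * L"
  proof -
    have "G * C = - (A * (H * C))"
      using A C H by (simp add: G assoc_mult_mat[OF A H C])
    moreover have "A * L = A * 1\<^sub>m n - A * (H * C)"
      unfolding assms(13) using A HCc by (intro mult_minus_distrib_mat) auto
    ultimately show ?thesis using A HCc by (auto intro!: eq_matI)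
  qed

  \<comment> \<open>Error dynamics of the filter\<close>
  have error: "z t - x t \<in> carrier_vec n
      \<and> z (Suc t) - x (Suc t) = (A * L) *\<^sub>v (z t - x t) - B *\<^sub>v u t
      \<and> xe t = x t + L *\<^sub>v (z t - x t)"
    if sys: "state_trajectory A B u x" and fil: "filter_trajectory A C G H L x z xe"
    for u x z xe t
  proof -
    have x: "x t \<in> carrier_vec n" and z: "z t \<in> carrier_vec n" and u: "u t \<in> carrier_vec (card K)"
      using sys fil A B by (auto simp: state_trajectory_def filter_trajectory_def)
    have x': "x (Suc t) = A *\<^sub>v x t + B *\<^sub>v u t"
      using sys by (simp add: state_trajectory_def)
    have z': "z (Suc t) = (A * L) *\<^sub>v z t - (G * C) *\<^sub>v x t"
      and xe: "xe t = L *\<^sub>v z t + (H * C) *\<^sub>v x t"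
      using fil by (auto simp: filter_trajectory_def closed_loop)
    \<comment> \<open>Written this way, the output term of the filter and the free motion of
      \<open>x\<close> combine into \<open>(A * L) *\<^sub>v x t\<close>, so \<open>z\<close> and
      \<open>x\<close> are propagated by the same matrix and only the input, unseen by the filter,
      remains.\<close>
    have ALx: "(A * L) *\<^sub>v x t = A *\<^sub>v x t + (G * C) *\<^sub>v x t"
      unfolding closed_loop[symmetric] using A GC x by (rule add_mult_distrib_mat_vec)
    have "z (Suc t) - x (Suc t) = (A * L) *\<^sub>v z t - (A * L) *\<^sub>v x t - B *\<^sub>v u t"
      unfolding z' x' ALx using A B GC AL x z u by (intro eq_vecI) auto
    also have "(A * L) *\<^sub>v z t - (A * L) *\<^sub>v x t = (A * L) *\<^sub>v (z t - x t)"
      using AL z x by (rule mult_minus_distrib_mat_vec[symmetric])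
    finally have 1: "z (Suc t) - x (Suc t) = (A * L) *\<^sub>v (z t - x t) - B *\<^sub>v u t" .
    have "L *\<^sub>v x t = x t - (H * C) *\<^sub>v x t"
      unfolding assms(13) using minus_mult_distrib_mat_vec[OF one_carrier_mat HCc x] x by simp
    then have "xe t = x t + L *\<^sub>v (z t - x t)"
      unfolding xe mult_minus_distrib_mat_vec[OF L z x] using x z L HCc by (intro eq_vecI) auto
    with 1 show ?thesis using x z by auto
  qed
  show ?thesis
  proof (intro conjI allI impI)

    \<comment> \<open>The residual without input\<close>
    fix u x z xe
    assume sys: "state_trajectory A B u x" and fil: "filter_trajectory A C G H L x z xe"
      and u0: "\<forall>t. u t = 0\<^sub>v (card K)"
    define e where "e t = z t - x t" for t
    have e: "e t \<in> carrier_vec n" and xe: "xe t = x t + L *\<^sub>v e t" for t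
      using error[OF sys fil] by (auto simp: e_def)
    have Bu: "B *\<^sub>v u t = 0\<^sub>v n" for t using u0 B by auto
    have eS: "e (Suc t) = (A * L) *\<^sub>v e t" for t
      using error[OF sys fil, of t] AL e[of t] unfolding e_def[symmetric] Bu
      by (auto intro!: eq_vecI)
    have e0: "(\<lambda>t. e t $ i) \<longlonglongrightarrow> 0" if "i < n" for i
      using e eS that by (rule stable)
    have x: "x t \<in> carrier_vec n" "x (Suc t) = A *\<^sub>v x t" for t
      using sys A Bu by (auto simp: state_trajectory_def)
    \<comment> \<open>As \<open>A\<close> carries \<open>x t\<close> to \<open>x (Suc t)\<close> and
      \<open>L *\<^sub>v e t\<close> to \<open>e (Suc t)\<close>, the residual is
      \<open>L - I\<close> applied to the next error, which tends to zero.\<close>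
    have residual: "xe (Suc t) - A *\<^sub>v xe t = L *\<^sub>v e (Suc t) - e (Suc t)" for t
    proof -
      have "A *\<^sub>v xe t = x (Suc t) + e (Suc t)"
        unfolding xe eS x(2) using A L x(1)[of t] e[of t]
        by (simp add: mult_add_distrib_mat_vec[OF A] assoc_mult_mat_vec[OF A L])
      then show ?thesis
        unfolding xe using x(1)[of "Suc t"] e[of "Suc t"] L by (intro eq_vecI) auto
    qed
    show "converges_to_zero (\<lambda>t. xe (Suc t) - A *\<^sub>v xe t)"
      unfolding residual
    proof (rule converges_to_zeroI)
      show "L *\<^sub>v e (Suc t) - e (Suc t) \<in> carrier_vec n" for t using L e by simp
      fix i assume i: "i < n"
      have "(\<lambda>t. (L *\<^sub>v e t) $ i - e t $ i) \<longlonglongrightarrow> 0 - 0"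
        using mult_mat_vec_tendsto_0[OF L e e0 i] e0[OF i] by (intro tendsto_diff) auto
      then have "(\<lambda>t. (L *\<^sub>v e (Suc t)) $ i - e (Suc t) $ i) \<longlonglongrightarrow> 0"
        by (intro LIMSEQ_Suc) simp
      moreover have "(L *\<^sub>v e (Suc t) - e (Suc t)) $ i = (L *\<^sub>v e (Suc t)) $ i - e (Suc t) $ i" for t
        using i e[of "Suc t"] by auto
      ultimately show "(\<lambda>t. (L *\<^sub>v e (Suc t) - e (Suc t)) $ i) \<longlonglongrightarrow> 0" by simp
    qed
  next

    \<comment> \<open>State estimation when the misbehaving agents are neighbors\<close>
    fix u x z xe
    assume KN: "K \<subseteq> neighbors A j"
      and sys: "state_trajectory A B u x" and fil: "filter_trajectory A C G H L x z xe"
    define e where "e t = z t - x t" for t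
    have e: "e t \<in> carrier_vec n" and eS: "e (Suc t) = (A * L) *\<^sub>v e t - B *\<^sub>v u t"
      and xe: "xe t = x t + L *\<^sub>v e t" for t
      using error[OF sys fil] by (auto simp: e_def)
    have u: "u t \<in> carrier_vec (card K)" for t
      using sys B by (auto simp: state_trajectory_def)
    \<comment> \<open>The columns of \<open>B\<close> are unit vectors with indices in
      \<open>K\<close>, hence supported on the neighbors, which are exactly the coordinates that
      \<open>L\<close> removes.\<close>
    have B0: "B $$ (i, k) = 0" if "i < n" "i \<notin> set ns" "k < card K" for i k
    proof -
      have k: "k < length ks" using that(3) assms(3,4) distinct_card by metis
      then have "ks ! k \<in> K" "ks ! k \<noteq> i" using nth_mem[OF k] assms(4,7) KN that(2) by auto
      then show ?thesis
        using that k assms(2) by (auto simp: assms(8) input_matrix_def mat_of_cols_def)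
    qed
    have LBu: "L *\<^sub>v (B *\<^sub>v u t) = 0\<^sub>v n" for t
    proof (rule eq_vecI)
      fix i assume "i < dim_vec (0\<^sub>v n :: real vec)"
      then have i: "i < n" by simp
      have "(B *\<^sub>v u t) $ i = 0" if "i \<notin> set ns"
        using B u[of t] i that by (auto simp: scalar_prod_def B0)
      moreover have "B *\<^sub>v u t \<in> carrier_vec n" using B u[of t] by auto
      ultimately show "(L *\<^sub>v (B *\<^sub>v u t)) $ i = 0\<^sub>v n $ i"
        using i by (simp add: Lv)
    qed (use L in auto)
    \<comment> \<open>The error \<open>e\<close> need not converge under an arbitrary input. Its
      image \<open>y\<close> is free of the current input, and since \<open>L\<close> annihilates
      the range of \<open>B\<close>, it obeys the autonomous recursion of
      \<open>A * L\<close>.\<close>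
    define y where "y t = (A * L) *\<^sub>v e t" for t
    have y: "y t \<in> carrier_vec n" for t using AL e by (simp add: y_def)
    have LeS: "L *\<^sub>v e (Suc t) = L *\<^sub>v y t" for t
    proof -
      have "L *\<^sub>v e (Suc t) = L *\<^sub>v y t - L *\<^sub>v (B *\<^sub>v u t)"
        unfolding eS y_def[symmetric] using L y B u
        by (intro mult_minus_distrib_mat_vec[OF L]) auto
      then show ?thesis using LBu L y[of t] by (auto intro!: eq_vecI)
    qed
    have "y (Suc t) = (A * L) *\<^sub>v y t" for t
      using LeS[of t] A L e y by (simp add: y_def[of "Suc t"] assoc_mult_mat_vec[OF A L])
    then have y0: "(\<lambda>t. y t $ i) \<longlonglongrightarrow> 0" if "i < n" for i
      using y that by (intro stable)
    have diff: "xe t - x t = L *\<^sub>v e t" for t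
    proof -
      have "x t \<in> carrier_vec n" using sys A by (auto simp: state_trajectory_def)
      then show ?thesis unfolding xe using L e[of t] by (intro eq_vecI) auto
    qed
    show "converges_to_zero (\<lambda>t. xe t - x t)"
      unfolding diff
    proof (rule converges_to_zeroI)
      show "L *\<^sub>v e t \<in> carrier_vec n" for t using L e by simp
      fix i assume "i < n"
      \<comment> \<open>\<open>LeS\<close> expresses the estimation error through \<open>y\<close>
        only from time 1 on; the arbitrary initial term does not affect the limit.\<close>
      then have "(\<lambda>t. (L *\<^sub>v e (Suc t)) $ i) \<longlonglongrightarrow> 0"
        unfolding LeS using L y y0 by (intro mult_mat_vec_tendsto_0)
      then show "(\<lambda>t. (L *\<^sub>v e t) $ i) \<longlonglongrightarrow> 0" by (rule LIMSEQ_imp_Suc)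
    qed
  qed
qed

end
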